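(* For every continuous surjection $g\colon[0,1]\to[0,1]$ and every $\varepsilon>0$ there is $\delta>0$ such that for every $\delta$-crooked continuous surjection $f\colon[0,1]\to[0,1]$ there is a continuous surjection $h\colon[0,1]\to[0,1]$ such that $f\approx_\varepsilon g\circ h$.
   Context: For maps $f,f'\colon[0,1]\to[0,1]$, $f\approx_\varepsilon f'$ means $\sup_{x}|f(x)-f'(x)|<\varepsilon$. A continuous map $f\colon[0,1]\to[0,1]$ is $\delta$-crooked if for every $x\le y$ in $[0,1]$ there are $x\le y'\le x'\le y$ such that $|f(x)-f(x')|<\delta$ and $|f(y)-f(y')|<\delta$. *)

theory Defs
  imports "HOL-Analysis.Analysis"
begin

text \<open>Maps \<open>[0,1] \<rightarrow> [0,1]\<close> are functions on the reals of which only the values on \<open>{0..1}\<close> matter.\<close>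

definition cont_surj01 :: "(real \<Rightarrow> real) \<Rightarrow> bool" where
  "cont_surj01 f \<longleftrightarrow> continuous_on {0..1} f \<and> f ` {0..1} = {0..1}"

text \<open>The supremum is taken in the conditionally complete order of the reals, so it is
  meaningful only if \<open>f - f'\<close> is bounded on \<open>{0..1}\<close>, as it is for maps into \<open>{0..1}\<close>.\<close>

definition approx01 :: "real \<Rightarrow> (real \<Rightarrow> real) \<Rightarrow> (real \<Rightarrow> real) \<Rightarrow> bool" where
  "approx01 \<epsilon> f f' \<longleftrightarrow> (SUP x\<in>{0..1}. \<bar>f x - f' x\<bar>) < \<epsilon>"

definition crooked :: "real \<Rightarrow> (real \<Rightarrow> real) \<Rightarrow> bool" where
  "crooked \<delta> f \<longleftrightarrow>
     continuous_on {0..1} f \<and> f ` {0..1} \<subseteq> {0..1} \<and>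
     (\<forall>x\<in>{0..1}. \<forall>y\<in>{0..1}. x \<le> y \<longrightarrow>
        (\<exists>y' x'. x \<le> y' \<and> y' \<le> x' \<and> x' \<le> y \<and>
                 \<bar>f x - f x'\<bar> < \<delta> \<and> \<bar>f y - f y'\<bar> < \<delta>))"

end

theory Submission
  imports Defs
begin

text \<open>Composing \<open>g\<close> with a suitable path onto \<open>[0,1]\<close>, we may assume that \<open>g\<close> has its minimum at
  the left end and its maximum at the right end of its interval. If \<open>g\<close> has no drop larger than
  \<open>\<epsilon>\<close>, it has an approximate inverse \<open>\<psi>\<close>, and \<open>h\<close> is essentially \<open>\<psi> \<circ> f\<close>. Otherwise cut \<open>g\<close> at the
  ends \<open>s < t\<close> of a largest drop and lift the truncations of \<open>f\<close> through the three pieces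
  inductively. The first lift is good where \<open>f\<close> is below \<open>g s\<close>, the third where \<open>f\<close> is above \<open>g t\<close>.
  Whenever \<open>f\<close> crosses from one of these levels to the other, crookedness makes it cross back
  and forth once more, and the middle lift, on the middle crossing, connects the other two.\<close>

section \<open>Gluing continuous selections\<close>

text \<open>\<open>R x w\<close> says that \<open>w\<close> is an admissible value at
  \<open>x\<close>. Keeping \<open>R\<close> abstract separates the gluing on subintervals from the
  estimates that make a lift good.\<close>

definition section_on :: "(real \<Rightarrow> real \<Rightarrow> bool) \<Rightarrow> real \<Rightarrow> real \<Rightarrow> (real \<Rightarrow> real) \<Rightarrow> bool" where
  "section_on R a b h \<longleftrightarrow> continuous_on {a..b} h \<and> (\<forall>x\<in>{a..b}. R x (h x))"

lemma section_on_join: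
  assumes "section_on R a b h" "section_on R b c k" "h b = k b" "a \<le> b" "b \<le> c"
  shows "\<exists>m. section_on R a c m \<and> m a = h a \<and> m c = k c"
proof -
  define m where "m = (\<lambda>x. if x \<le> b then h x else k x)"
  have "continuous_on {a..c} m"
    unfolding m_def
  proof (rule continuous_on_cases_le)
    show "continuous_on {t \<in> {a..c}. t \<le> b} h" "continuous_on {t \<in> {a..c}. b \<le> t} k"
      using assms by (auto simp: section_on_def intro: continuous_on_subset)
  qed (use assms in auto)
  moreover have "\<forall>x\<in>{a..c}. R x (m x)"
    using assms by (auto simp: section_on_def m_def)
  moreover have "m a = h a" "m c = k c"
    using assms by (auto simp: m_def)
  ultimately show ?thesis
    unfolding section_on_def by blast
qed

lemma section_on_join3:
  assumes "section_on R a b h" "section_on R b c k" "section_on R c d l"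
    and "h b = k b" "k c = l c" "a \<le> b" "b \<le> c" "c \<le> d"
  shows "\<exists>m. section_on R a d m \<and> m a = h a \<and> m d = l d"
proof -
  obtain m where "section_on R a c m" "m a = h a" "m c = k c"
    using section_on_join[of R a b h c k] assms by blast
  then show ?thesis
    using section_on_join[of R a c m d l] assms by auto
qed

text \<open>The section follows \<open>k i\<close> until it has to enter \<open>C (\<not> i)\<close>, and changes over to \<open>k (\<not> i)\<close>
  on the last gap before that. Disjoint compact sets have positive distance, so there are
  finitely many changes.\<close>

lemma section_on_alternating:
  fixes C :: "bool \<Rightarrow> real set" and k :: "bool \<Rightarrow> real \<Rightarrow> real"
  assumes "a \<le> b"
    and closed: "\<And>i. closed (C i)" and disj: "C True \<inter> C False = {}"
    and cont: "\<And>i. continuous_on {a..b} (k i)"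
    and R: "\<And>i x. x \<in> {a..b} \<Longrightarrow> x \<notin> C (\<not> i) \<Longrightarrow> R x (k i x)"
    and cross: "\<And>i x y. \<lbrakk>a \<le> x; x < y; y \<le> b; x \<in> C i; y \<in> C (\<not> i);
        \<And>z. x < z \<Longrightarrow> z < y \<Longrightarrow> z \<notin> C True \<union> C False\<rbrakk>
      \<Longrightarrow> \<exists>m. section_on R x y m \<and> m x = k i x \<and> m y = k (\<not> i) y"
  shows "\<exists>m. section_on R a b m"
proof -
  have disj': "x \<notin> C (\<not> i)" if "x \<in> C i" for x i
    using disj that by (cases i) auto
  have k: "section_on R p q (k i)"
    if "a \<le> p" "q \<le> b" "\<And>z. z \<in> {p..q} \<Longrightarrow> z \<notin> C (\<not> i)" for p q i
    unfolding section_on_def using that R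
    by (intro conjI continuous_on_subset[OF cont[of i]]) auto
  have "\<exists>d>0. \<forall>x\<in>{a..b} \<inter> C True. \<forall>y\<in>C False. d \<le> dist x y"
    using disj closed by (intro separate_compact_closed) (auto intro: compact_Int_closed)
  then obtain d where "d > 0" and "\<And>x y. x \<in> {a..b} \<inter> C True \<Longrightarrow> y \<in> C False \<Longrightarrow> d \<le> dist x y"
    by blast
  then have d: "d \<le> y - x" if "x < y" "x \<in> {a..b}" "y \<in> {a..b}" "x \<in> C i" "y \<in> C (\<not> i)" for x y i
    using that by (cases i) (fastforce simp: dist_real_def)+
  have from_C: "\<exists>m. section_on R p b m \<and> m p = k i p"
    if "p \<in> C i" "a \<le> p" "p \<le> b" "b - p \<le> real n * d" for p i n
    using that
  proof (induction n arbitrary: p i)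
    case 0
    then have "p = b" by simp
    then show ?case
      using 0 disj' k[of p b i] by auto
  next
    case (Suc n)
    show ?case
    proof (cases "C (\<not> i) \<inter> {p..b} = {}")
      case True
      then have "section_on R p b (k i)"
        using Suc.prems by (intro k) auto
      then show ?thesis by blast
    next
      case False
      have "compact (C (\<not> i) \<inter> {p..b})"
        using closed by (simp add: closed_Int_compact)
      \<comment> \<open>\<open>y\<close> is the first point of the other set after \<open>p\<close>,
        and \<open>x\<close> below is the last point of \<open>C i\<close> before \<open>y\<close>.
        Hence the open interval between them misses both sets and \<open>cross\<close>
        applies.\<close>
      then obtain y where "y \<in> C (\<not> i) \<inter> {p..b}"
        and y_le: "\<And>z. z \<in> C (\<not> i) \<inter> {p..b} \<Longrightarrow> y \<le> z"
        using compact_attains_inf[OF _ False] by metis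
      then have y: "y \<in> C (\<not> i)" "p \<le> y" "y \<le> b" by auto
      have "compact (C i \<inter> {p..y})"
        using closed by (simp add: closed_Int_compact)
      moreover have "C i \<inter> {p..y} \<noteq> {}"
        using Suc.prems y by auto
      ultimately obtain x where "x \<in> C i \<inter> {p..y}"
        and x_ge: "\<And>z. z \<in> C i \<inter> {p..y} \<Longrightarrow> z \<le> x"
        using compact_attains_sup[of "C i \<inter> {p..y}"] by metis
      then have x: "x \<in> C i" "p \<le> x" "x \<le> y" by auto
      have "x < y"
        using x y disj' by (metis order_le_less)
      moreover have "z \<notin> C True \<union> C False" if "x < z" "z < y" for z
      proof -
        have "z \<notin> C i" "z \<notin> C (\<not> i)"
          using x_ge[of z] y_le[of z] that x y by auto
        then show ?thesis by (cases i) auto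
      qed
      ultimately obtain m where m: "section_on R x y m" "m x = k i x" "m y = k (\<not> i) y"
        using cross[of x y i] x y Suc.prems by auto
      have "z \<notin> C (\<not> i)" if "z \<in> {p..x}" for z
        using y_le[of z] that \<open>x < y\<close> y by auto
      then have "section_on R p x (k i)"
        using k[of p x i] Suc.prems x y by auto
      then obtain m1 where m1: "section_on R p y m1" "m1 p = k i p" "m1 y = k (\<not> i) y"
        using section_on_join[of R p x "k i" y m] m x by metis
      have "b - y \<le> real n * d"
        using d[of x y i] \<open>x < y\<close> x y Suc.prems by (auto simp: algebra_simps)
      then obtain m2 where "section_on R y b m2" "m2 y = k (\<not> i) y"
        using Suc.IH[of y "\<not> i"] y Suc.prems by auto
      then show ?thesis
        using section_on_join[of R p y m1 b m2] m1 y by metis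
    qed
  qed
  show ?thesis
  proof (cases "(C True \<union> C False) \<inter> {a..b} = {}")
    case True
    then have "section_on R a b (k True)"
      by (intro k) auto
    then show ?thesis by blast
  next
    case False
    have "compact ((C True \<union> C False) \<inter> {a..b})"
      using closed by (intro closed_Int_compact closed_Un) auto
    then obtain p where "p \<in> (C True \<union> C False) \<inter> {a..b}"
      and p_le: "\<And>z. z \<in> (C True \<union> C False) \<inter> {a..b} \<Longrightarrow> p \<le> z"
      using compact_attains_inf[OF _ False] by metis
    then have p: "p \<in> C True \<union> C False" "a \<le> p" "p \<le> b" by auto
    obtain i where i: "p \<in> C i" using p by blast
    obtain n where "b - p \<le> real n * d"
      using \<open>d > 0\<close> by (metis less_imp_le reals_Archimedean3)
    then obtain m where m: "section_on R p b m" "m p = k i p"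
      using from_C i p by blast
    have "z \<notin> C (\<not> i)" if "z \<in> {a..p}" for z
    proof (cases "z = p")
      case True
      then show ?thesis using disj' i by blast
    next
      case False
      then show ?thesis using p_le[of z] that p by (cases i) auto
    qed
    then have "section_on R a p (k i)"
      using p by (intro k) auto
    then show ?thesis
      using section_on_join[of R a p "k i" b m] m p by metis
  qed
qed

section \<open>Approximate inverses of maps without large drops\<close>

text \<open>The intermediate value theorem cuts off pieces on which \<open>g\<close> rises by
  exactly \<epsilon>, leaving a last rise of at most \<epsilon>. Over each piece a linear path
  between its ends is already accurate enough.\<close>

lemma almost_monotone_approx_inverse:
  fixes g :: "real \<Rightarrow> real"
  assumes "continuous_on {u..v} g" "u \<le> v" "g u < g v" "g v - g u \<le> real n * \<epsilon>"
    and "\<And>x y. u \<le> x \<Longrightarrow> x \<le> y \<Longrightarrow> y \<le> v \<Longrightarrow> g x - g y \<le> \<epsilon>"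
  shows "\<exists>\<psi>. section_on (\<lambda>z w. w \<in> {u..v} \<and> \<bar>g w - z\<bar> \<le> 2 * \<epsilon>) (g u) (g v) \<psi>
    \<and> \<psi> (g u) = u \<and> \<psi> (g v) = v"
  using assms
proof (induction n arbitrary: u)
  case 0
  then show ?case by simp
next
  case (Suc n)
  note cont = Suc.prems(1) and drop = Suc.prems(5)
  have short: "\<exists>\<psi>. section_on (\<lambda>z w. w \<in> {u..v} \<and> \<bar>g w - z\<bar> \<le> 2 * \<epsilon>) (g u) (g x) \<psi>
      \<and> \<psi> (g u) = u \<and> \<psi> (g x) = x"
    if x: "u \<le> x" "x \<le> v" "g u < g x" "g x - g u \<le> \<epsilon>" for x
  proof -
    define \<psi> where "\<psi> = (\<lambda>z. u + (z - g u) / (g x - g u) * (x - u))"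
    have "\<psi> z \<in> {u..x}" if z: "z \<in> {g u..g x}" for z
    proof -
      have "0 \<le> (z - g u) / (g x - g u)" "(z - g u) / (g x - g u) \<le> 1"
        using z x by auto
      then have "0 \<le> (z - g u) / (g x - g u) * (x - u)" "(z - g u) / (g x - g u) * (x - u) \<le> x - u"
        using x by (simp_all only: diff_ge_0_iff_ge mult_left_le_one_le mult_nonneg_nonneg)
      then show ?thesis
        unfolding \<psi>_def by auto
    qed
    \<comment> \<open>The drop bound keeps \<open>g w\<close> between
      \<open>g u - \<epsilon>\<close> and \<open>g x + \<epsilon>\<close>, while \<open>z\<close>
      lies in an interval of length at most \<epsilon>.\<close>
    moreover have "\<bar>g w - z\<bar> \<le> 2 * \<epsilon>" if "w \<in> {u..x}" "z \<in> {g u..g x}" for w z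
      using that drop[of u w] drop[of w x] x by (auto simp: abs_le_iff)
    ultimately have "\<forall>z\<in>{g u..g x}. \<psi> z \<in> {u..v} \<and> \<bar>g (\<psi> z) - z\<bar> \<le> 2 * \<epsilon>"
      using x by fastforce
    moreover have "continuous_on {g u..g x} \<psi>"
      unfolding \<psi>_def using x by (intro continuous_intros) auto
    moreover have "\<psi> (g u) = u" "\<psi> (g x) = x"
      using x by (auto simp: \<psi>_def)
    ultimately show ?thesis
      unfolding section_on_def by blast
  qed
  show ?case
  proof (cases "g v - g u \<le> \<epsilon>")
    case True
    then show ?thesis using short[of v] Suc.prems by auto
  next
    case False
    have "\<epsilon> \<ge> 0" using drop[of u u] Suc.prems by auto
    moreover have "\<epsilon> \<noteq> 0" using Suc.prems by auto
    ultimately have "\<epsilon> > 0" by simp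
    obtain x where x: "u \<le> x" "x \<le> v" "g x = g u + \<epsilon>"
      using IVT'[of g u "g u + \<epsilon>" v] False \<open>\<epsilon> > 0\<close> Suc.prems by auto
    have "\<exists>\<psi>. section_on (\<lambda>z w. w \<in> {x..v} \<and> \<bar>g w - z\<bar> \<le> 2 * \<epsilon>) (g x) (g v) \<psi>
      \<and> \<psi> (g x) = x \<and> \<psi> (g v) = v"
    proof (rule Suc.IH)
      show "continuous_on {x..v} g"
        using cont x by (auto intro: continuous_on_subset)
      show "g v - g x \<le> real n * \<epsilon>"
        using Suc.prems x by (simp add: algebra_simps)
    qed (use x False drop in auto)
    then obtain \<psi>2 where "section_on (\<lambda>z w. w \<in> {u..v} \<and> \<bar>g w - z\<bar> \<le> 2 * \<epsilon>) (g x) (g v) \<psi>2"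
      and \<psi>2: "\<psi>2 (g x) = x" "\<psi>2 (g v) = v"
      using x unfolding section_on_def by fastforce
    moreover obtain \<psi>1 where "section_on (\<lambda>z w. w \<in> {u..v} \<and> \<bar>g w - z\<bar> \<le> 2 * \<epsilon>) (g u) (g x) \<psi>1"
      and \<psi>1: "\<psi>1 (g u) = u" "\<psi>1 (g x) = x"
      using short[of x] x \<open>\<epsilon> > 0\<close> by auto
    ultimately show ?thesis
      using section_on_join[of _ "g u" "g x" \<psi>1 "g v" \<psi>2] x False \<open>\<epsilon> > 0\<close> by fastforce
  qed
qed

section \<open>Lifting truncations of crooked maps\<close>

text \<open>The last two clauses, which force the lift to sit at an end of \<open>{u..v}\<close>, make the lifts through
  adjacent pieces of \<open>g\<close> agree where they are to be joined.\<close>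

definition clamp_lift ::
    "real \<Rightarrow> real \<Rightarrow> (real \<Rightarrow> real) \<Rightarrow> real \<Rightarrow> real \<Rightarrow> (real \<Rightarrow> real) \<Rightarrow> real \<Rightarrow> real \<Rightarrow> bool" where
  "clamp_lift \<epsilon> \<eta> g u v f x w \<longleftrightarrow>
     w \<in> {u..v} \<and> \<bar>g w - max (g u) (min (g v) (f x))\<bar> \<le> 3 * \<epsilon> \<and>
     (f x \<le> g u + \<eta> \<longrightarrow> w = u) \<and> (f x \<ge> g v - \<eta> \<longrightarrow> w = v)"

text \<open>A single \<eta> is both the crookedness of \<open>f\<close> and the margin in which the
  lift rests at an end. Shrinking it weakens both demands, so constants of different pieces can be
  replaced by a smaller common one.\<close>

definition crooked_liftable :: "real \<Rightarrow> (real \<Rightarrow> real) \<Rightarrow> real \<Rightarrow> real \<Rightarrow> real \<Rightarrow> bool" where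
  "crooked_liftable \<epsilon> g u v \<eta> \<longleftrightarrow>
     (\<forall>f. crooked \<eta> f \<longrightarrow> (\<exists>h. section_on (clamp_lift \<epsilon> \<eta> g u v f) 0 1 h))"

lemma crooked_mono: "crooked \<delta> f \<Longrightarrow> \<delta> \<le> \<delta>' \<Longrightarrow> crooked \<delta>' f"
  unfolding crooked_def by (meson order_less_le_trans)

lemma crooked_liftable_antimono:
  assumes "crooked_liftable \<epsilon> g u v \<eta>" "\<eta>' \<le> \<eta>"
  shows "crooked_liftable \<epsilon> g u v \<eta>'"
proof -
  have "clamp_lift \<epsilon> \<eta> g u v f x w \<Longrightarrow> clamp_lift \<epsilon> \<eta>' g u v f x w" for f x w
    using assms(2) unfolding clamp_lift_def by auto
  then show ?thesis
    using assms crooked_mono unfolding crooked_liftable_def section_on_def by metis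
qed

text \<open>The lift is an approximate inverse of \<open>g\<close> after a slight stretching of
  \<open>f\<close>. The inverse costs \<open>2 * \<epsilon>\<close> and the stretching at most
  \<epsilon>.\<close>

lemma crooked_liftable_almost_monotone:
  fixes g :: "real \<Rightarrow> real"
  assumes "continuous_on {u..v} g" "u \<le> v" "\<epsilon> > 0" "g v - g u \<ge> \<epsilon>"
    and "\<And>x y. u \<le> x \<Longrightarrow> x \<le> y \<Longrightarrow> y \<le> v \<Longrightarrow> g x - g y \<le> \<epsilon>"
  shows "crooked_liftable \<epsilon> g u v (\<epsilon> / 4)"
  unfolding crooked_liftable_def
proof (intro allI impI)
  fix f assume f: "crooked (\<epsilon> / 4) f"
  obtain n where "g v - g u \<le> real n * \<epsilon>"
    using \<open>\<epsilon> > 0\<close> by (metis less_imp_le reals_Archimedean3)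
  then obtain \<psi> where
    \<psi>: "section_on (\<lambda>z w. w \<in> {u..v} \<and> \<bar>g w - z\<bar> \<le> 2 * \<epsilon>) (g u) (g v) \<psi>"
    "\<psi> (g u) = u" "\<psi> (g v) = v"
    using almost_monotone_approx_inverse[of u v g n \<epsilon>] assms by auto
  \<comment> \<open>Values are pushed away from the midpoint by up to \<open>\<epsilon> / 4\<close>
    and then truncated. As \<open>g v - g u \<ge> \<epsilon>\<close>, the full push acts within
    \<open>\<epsilon> / 4\<close> of either end, so these values land on the end itself.\<close>
  define \<sigma> where "\<sigma> = (\<lambda>z. max (g u) (min (g v)
    (z + max (- (\<epsilon> / 4)) (min (\<epsilon> / 4) (z - (g u + g v) / 2)))))"
  have \<sigma>: "\<sigma> z \<in> {g u..g v}" "\<bar>\<sigma> z - max (g u) (min (g v) z)\<bar> \<le> \<epsilon>"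
    "z \<le> g u + \<epsilon> / 4 \<Longrightarrow> \<sigma> z = g u" "z \<ge> g v - \<epsilon> / 4 \<Longrightarrow> \<sigma> z = g v" for z
    using assms(3,4) by (auto simp: \<sigma>_def max_def min_def abs_if field_simps)
  have "continuous_on {0..1} (\<lambda>x. \<psi> (\<sigma> (f x)))"
  proof (rule continuous_on_compose2[of "{g u..g v}" \<psi>])
    show "continuous_on {g u..g v} \<psi>" using \<psi> by (simp add: section_on_def)
    show "continuous_on {0..1} (\<lambda>x. \<sigma> (f x))"
      using f unfolding crooked_def \<sigma>_def by (intro continuous_intros) auto
  qed (use \<sigma> in auto)
  moreover have "clamp_lift \<epsilon> (\<epsilon> / 4) g u v f x (\<psi> (\<sigma> (f x)))" for x
  proof -
    have "\<psi> (\<sigma> (f x)) \<in> {u..v}" "\<bar>g (\<psi> (\<sigma> (f x))) - \<sigma> (f x)\<bar> \<le> 2 * \<epsilon>"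
      using \<psi>(1) \<sigma>(1)[of "f x"] unfolding section_on_def by auto
    then show ?thesis
      using \<sigma>[of "f x"] \<psi> unfolding clamp_lift_def by auto
  qed
  ultimately show "\<exists>h. section_on (clamp_lift \<epsilon> (\<epsilon> / 4) g u v f) 0 1 h"
    unfolding section_on_def by blast
qed

text \<open>The lifts change over near the levels \<open>g t + 2 * \<eta>\<close> and
  \<open>g s - 2 * \<eta>\<close>, outside the margin \<eta> of the new lift. Crookedness adds an
  error below \<eta>, so the joints lie within \<open>3 * \<eta>\<close> of \<open>g t\<close> or
  \<open>g s\<close>, inside the margin \<open>4 * \<eta>\<close> where adjacent lifts agree. The
  falling middle piece is reflected to make it rise.\<close>

lemma crooked_liftable_zigzag:
  fixes g :: "real \<Rightarrow> real"
  assumes order: "u \<le> s" "s \<le> t" "t \<le> v"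
    and bounds: "\<And>x. x \<in> {u..v} \<Longrightarrow> g u \<le> g x \<and> g x \<le> g v"
    and \<eta>: "\<eta> > 0" "5 * \<eta> < g s - g t"
    and up1: "crooked_liftable \<epsilon> g u s (4 * \<eta>)"
    and down: "crooked_liftable \<epsilon> (\<lambda>x. g (- x)) (- t) (- s) (4 * \<eta>)"
    and up2: "crooked_liftable \<epsilon> g t v (4 * \<eta>)"
  shows "crooked_liftable \<epsilon> g u v \<eta>"
  unfolding crooked_liftable_def
proof (intro allI impI)
  fix f assume f: "crooked \<eta> f"
  then have f': "crooked (4 * \<eta>) f"
    using crooked_mono[of \<eta> f "4 * \<eta>"] \<eta> by simp
  have st: "g u \<le> g s" "g s \<le> g v" "g u \<le> g t" "g t \<le> g v"
    using bounds order by auto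
  obtain h1 where h1: "section_on (clamp_lift \<epsilon> (4 * \<eta>) g u s f) 0 1 h1"
    using up1 f' unfolding crooked_liftable_def by blast
  obtain h2' where h2': "section_on (clamp_lift \<epsilon> (4 * \<eta>) (\<lambda>x. g (- x)) (- t) (- s) f) 0 1 h2'"
    using down f' unfolding crooked_liftable_def by blast
  define h2 where "h2 = (\<lambda>x. - h2' x)"
  obtain h3 where h3: "section_on (clamp_lift \<epsilon> (4 * \<eta>) g t v f) 0 1 h3"
    using up2 f' unfolding crooked_liftable_def by blast
  have h2_cont: "continuous_on {0..1} h2"
    using h2' unfolding section_on_def h2_def by (intro continuous_intros) auto
  define R where "R = clamp_lift \<epsilon> \<eta> g u v f"
  \<comment> \<open>Below \<open>g s\<close> the truncations at \<open>g s\<close> and at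
    \<open>g v\<close> agree, and \<open>f x\<close> is too low for the clause that forces the value
    \<open>v\<close>. The other two lifts are handled alike.\<close>
  have R1: "R x (h1 x)" if "x \<in> {0..1}" "f x < g s - 2 * \<eta>" for x
  proof -
    have "clamp_lift \<epsilon> (4 * \<eta>) g u s f x (h1 x)"
      using h1 that unfolding section_on_def by blast
    then show ?thesis
      using that st \<eta> order unfolding R_def clamp_lift_def
      by (auto simp: max_def min_def split: if_splits)
  qed
  have R2: "R x (h2 x)" if "x \<in> {0..1}" "g t + 2 * \<eta> \<le> f x" "f x \<le> g s - 2 * \<eta>" for x
  proof -
    have "clamp_lift \<epsilon> (4 * \<eta>) (\<lambda>x. g (- x)) (- t) (- s) f x (h2' x)"
      using h2' that unfolding section_on_def by blast
    then show ?thesis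
      using that st \<eta> order unfolding R_def h2_def clamp_lift_def
      by (auto simp: max_def min_def split: if_splits)
  qed
  have R3: "R x (h3 x)" if "x \<in> {0..1}" "g t + 2 * \<eta> < f x" for x
  proof -
    have "clamp_lift \<epsilon> (4 * \<eta>) g t v f x (h3 x)"
      using h3 that unfolding section_on_def by blast
    then show ?thesis
      using that st \<eta> order unfolding R_def clamp_lift_def
      by (auto simp: max_def min_def split: if_splits)
  qed
  have at_s: "h1 x = s" "h2 x = s" if "x \<in> {0..1}" "f x \<ge> g s - 4 * \<eta>" for x
    using h1 h2' that unfolding section_on_def clamp_lift_def h2_def by auto
  have at_t: "h2 x = t" "h3 x = t" if "x \<in> {0..1}" "f x \<le> g t + 4 * \<eta>" for x
    using h3 h2' that unfolding section_on_def clamp_lift_def h2_def by auto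
  have f_cont: "continuous_on {0..1} f"
    using f unfolding crooked_def by blast
  \<comment> \<open>\<open>C True\<close> is where \<open>f\<close> is too low for
    \<open>h3\<close>, and \<open>C False\<close> where it is too high for
    \<open>h1\<close>.\<close>
  define C where "C = (\<lambda>i. if i then {0..1} \<inter> f -` {..g t + 2 * \<eta>} else {0..1} \<inter> f -` {g s - 2 * \<eta>..})"
  define k where "k = (\<lambda>i. if i then h1 else h3)"
  have "\<exists>m. section_on R 0 1 m"
  proof (rule section_on_alternating[of 0 1 C k R])
    show "closed (C i)" for i
      unfolding C_def using f_cont by (auto intro!: continuous_closed_preimage)
    show "C True \<inter> C False = {}"
      using \<eta> by (auto simp: C_def)
    show "continuous_on {0..1} (k i)" for i
      using h1 h3 by (auto simp: k_def section_on_def)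
    show "R x (k i x)" if "x \<in> {0..1}" "x \<notin> C (\<not> i)" for i x
      using that R1[of x] R3[of x] by (cases i) (auto simp: C_def k_def)
  next
    fix i x y
    assume xy: "0 \<le> x" "x < y" "y \<le> 1" "x \<in> C i" "y \<in> C (\<not> i)"
      and gap: "\<And>z. x < z \<Longrightarrow> z < y \<Longrightarrow> z \<notin> C True \<union> C False"
    have mid: "g t + 2 * \<eta> < f z \<and> f z < g s - 2 * \<eta>" if "x < z" "z < y" for z
      using gap[OF that] that xy by (auto simp: C_def)
    obtain y' x' where 1: "x \<le> y'" "y' \<le> x'" "x' \<le> y"
      and 2: "\<bar>f x - f x'\<bar> < \<eta>" "\<bar>f y - f y'\<bar> < \<eta>"
    proof -
      have "x \<in> {0..1}" "y \<in> {0..1}" "x \<le> y" using xy by auto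
      then show thesis using f that unfolding crooked_def by blast
    qed
    have sub: "continuous_on {p..q} h1 \<and> continuous_on {p..q} h2 \<and> continuous_on {p..q} h3"
      if "x \<le> p" "q \<le> y" for p q
      using h1 h2_cont h3 that xy unfolding section_on_def by (auto intro: continuous_on_subset)
    show "\<exists>m. section_on R x y m \<and> m x = k i x \<and> m y = k (\<not> i) y"
    proof (cases i)
      case True
      have fx: "f x \<le> g t + 2 * \<eta>" and fy: "f y \<ge> g s - 2 * \<eta>"
        using xy True by (auto simp: C_def)
      \<comment> \<open>\<open>f y' > g s - 3 * \<eta>\<close> and
        \<open>f x \<le> g t + 2 * \<eta>\<close>, so a drop above \<open>5 * \<eta>\<close>
        separates \<open>x\<close> from \<open>y'\<close>; likewise \<open>x'\<close> from
        \<open>y\<close>. Thus \<open>y'\<close> and \<open>x'\<close> lie in the gap, where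
        \<open>mid\<close> holds.\<close>
      have "x < y'" "x' < y"
        using 1 2 fx fy \<eta> by (auto simp: order_less_le)
      have "section_on R x y' h1"
        using sub[of x y'] R1 mid fx \<eta> 1 xy \<open>x' < y\<close> unfolding section_on_def
        by (smt (verit) atLeastAtMost_iff)
      moreover have "section_on R y' x' h2"
        using sub[of y' x'] R2 mid \<eta> 1 xy \<open>x' < y\<close> \<open>x < y'\<close> unfolding section_on_def
        by (smt (verit) atLeastAtMost_iff)
      moreover have "section_on R x' y h3"
        using sub[of x' y] R3 mid fy \<eta> 1 xy \<open>x < y'\<close> unfolding section_on_def
        by (smt (verit) atLeastAtMost_iff)
      moreover have "h1 y' = h2 y'" "h2 x' = h3 x'"
        using at_s[of y'] at_t[of x'] fx fy 1 2 xy by auto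
      ultimately show ?thesis
        using section_on_join3[of R x y' h1 x' h2 y h3] 1 True by (simp add: k_def)
    next
      case False
      have fx: "f x \<ge> g s - 2 * \<eta>" and fy: "f y \<le> g t + 2 * \<eta>"
        using xy False by (auto simp: C_def)
      have "x < y'" "x' < y"
        using 1 2 fx fy \<eta> by (auto simp: order_less_le)
      have "section_on R x y' h3"
        using sub[of x y'] R3 mid fx \<eta> 1 xy \<open>x' < y\<close> unfolding section_on_def
        by (smt (verit) atLeastAtMost_iff)
      moreover have "section_on R y' x' h2"
        using sub[of y' x'] R2 mid \<eta> 1 xy \<open>x' < y\<close> \<open>x < y'\<close> unfolding section_on_def
        by (smt (verit) atLeastAtMost_iff)
      moreover have "section_on R x' y h1"
        using sub[of x' y] R1 mid fy \<eta> 1 xy \<open>x < y'\<close> unfolding section_on_def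
        by (smt (verit) atLeastAtMost_iff)
      moreover have "h3 y' = h2 y'" "h2 x' = h1 x'"
        using at_t[of y'] at_s[of x'] fx fy 1 2 xy by auto
      ultimately show ?thesis
        using section_on_join3[of R x y' h3 x' h2 y h1] 1 False by (simp add: k_def)
    qed
  qed simp
  then show "\<exists>h. section_on (clamp_lift \<epsilon> \<eta> g u v f) 0 1 h"
    unfolding R_def .
qed

section \<open>Induction along largest drops\<close>

text \<open>A map with its minimum at the left end and its maximum at the right end is cut at the
  ends of a largest drop: all three pieces are again of this kind up to reflection. If the drop
  is at least \<open>\<epsilon>\<close>, then all pieces are shorter by at least the modulus \<open>\<omega>\<close>.\<close>

lemma ex_crooked_liftable:
  fixes g :: "real \<Rightarrow> real"
  assumes "\<epsilon> > 0"
    and "continuous_on {u..v} g" "u \<le> v" "g v - g u \<ge> \<epsilon>" "v - u \<le> real n * \<omega>"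
    and "\<And>x. x \<in> {u..v} \<Longrightarrow> g u \<le> g x \<and> g x \<le> g v"
    and "\<And>x y. x \<in> {u..v} \<Longrightarrow> y \<in> {u..v} \<Longrightarrow> \<bar>x - y\<bar> < \<omega> \<Longrightarrow> \<bar>g x - g y\<bar> < \<epsilon>"
  shows "\<exists>\<eta>>0. crooked_liftable \<epsilon> g u v \<eta>"
  using assms(2-)
proof (induction n arbitrary: g u v)
  case 0
  then have "u = v" by simp
  then show ?case using 0 \<open>\<epsilon> > 0\<close> by simp
next
  case (Suc n)
  note cont = Suc.prems(1) and bounds = Suc.prems(5) and modulus = Suc.prems(6)
  define K where "K = {p \<in> {u..v} \<times> {u..v}. fst p \<le> snd p}"
  have "K = ({u..v} \<times> {u..v}) \<inter> {p. fst p \<le> snd p}"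
    by (auto simp: K_def)
  moreover have "closed {p :: real \<times> real. fst p \<le> snd p}"
    by (intro closed_Collect_le continuous_intros)
  ultimately have "compact K"
    by (simp add: compact_Int_closed compact_Times)
  moreover have "(u, u) \<in> K"
    using Suc.prems by (simp add: K_def)
  moreover have "continuous_on K (\<lambda>p. g (fst p) - g (snd p))"
    using cont by (intro continuous_intros continuous_on_compose2[OF cont]) (auto simp: K_def)
  ultimately obtain p where "p \<in> K" "\<forall>q\<in>K. g (fst q) - g (snd q) \<le> g (fst p) - g (snd p)"
    using continuous_attains_sup[of K "\<lambda>p. g (fst p) - g (snd p)"] by blast
  then obtain s t where order: "u \<le> s" "s \<le> t" "t \<le> v"
    and max: "\<And>x y. u \<le> x \<Longrightarrow> x \<le> y \<Longrightarrow> y \<le> v \<Longrightarrow> g x - g y \<le> g s - g t"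
    unfolding K_def by fastforce
  show ?case
  proof (cases "g s - g t \<le> \<epsilon>")
    case True
    then have "crooked_liftable \<epsilon> g u v (\<epsilon> / 4)"
      using Suc.prems \<open>\<epsilon> > 0\<close> max by (intro crooked_liftable_almost_monotone) force+
    then show ?thesis
      using \<open>\<epsilon> > 0\<close> by (intro exI[of _ "\<epsilon> / 4"]) auto
  next
    case False
    have st: "g u \<le> g s" "g s \<le> g v" "g u \<le> g t" "g t \<le> g v"
      using bounds order by auto
    \<comment> \<open>As \<open>g u \<le> g t\<close> and \<open>g s \<le> g v\<close>,
      \<open>g\<close> changes by at least \<open>g s - g t > \<epsilon>\<close> between the ends of
      each piece.\<close>
    have "\<omega> \<le> s - u" "\<omega> \<le> t - s" "\<omega> \<le> v - t"
      using modulus[of s u] modulus[of s t] modulus[of t v] st order False by force+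
    then have lengths: "s - u \<le> real n * \<omega>" "t - s \<le> real n * \<omega>" "v - t \<le> real n * \<omega>"
      using Suc.prems(4) order by (auto simp: algebra_simps)
    have "\<exists>\<eta>>0. crooked_liftable \<epsilon> g u s \<eta>"
    proof (rule Suc.IH)
      show "continuous_on {u..s} g" using cont order by (auto intro: continuous_on_subset)
      \<comment> \<open>A value above \<open>g s\<close> would give a larger drop to
        \<open>t\<close>. Maximality likewise puts the middle piece between \<open>g t\<close> and
        \<open>g s\<close>, and the last one above \<open>g t\<close>.\<close>
      show "g u \<le> g x \<and> g x \<le> g s" if "x \<in> {u..s}" for x
        using bounds[of x] max[of x t] that order by auto
      show "\<bar>g x - g y\<bar> < \<epsilon>" if "x \<in> {u..s}" "y \<in> {u..s}" "\<bar>x - y\<bar> < \<omega>" for x y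
        using modulus that order by auto
    qed (use order lengths False st in auto)
    then obtain \<eta>1 where \<eta>1: "\<eta>1 > 0" "crooked_liftable \<epsilon> g u s \<eta>1" by blast
    have "\<exists>\<eta>>0. crooked_liftable \<epsilon> (\<lambda>x. g (- x)) (- t) (- s) \<eta>"
    proof (rule Suc.IH)
      show "continuous_on {- t..- s} (\<lambda>x. g (- x))"
        using order by (intro continuous_on_compose2[OF cont] continuous_intros) auto
      show "g (- (- t)) \<le> g (- x) \<and> g (- x) \<le> g (- (- s))" if "x \<in> {- t..- s}" for x
        using max[of s "- x"] max[of "- x" t] that order by auto
      show "\<bar>g (- x) - g (- y)\<bar> < \<epsilon>" if "x \<in> {- t..- s}" "y \<in> {- t..- s}" "\<bar>x - y\<bar> < \<omega>" for x y
        using modulus[of "- x" "- y"] that order by auto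
    qed (use order lengths False st in auto)
    then obtain \<eta>2 where \<eta>2: "\<eta>2 > 0" "crooked_liftable \<epsilon> (\<lambda>x. g (- x)) (- t) (- s) \<eta>2" by blast
    have "\<exists>\<eta>>0. crooked_liftable \<epsilon> g t v \<eta>"
    proof (rule Suc.IH)
      show "continuous_on {t..v} g" using cont order by (auto intro: continuous_on_subset)
      show "g t \<le> g x \<and> g x \<le> g v" if "x \<in> {t..v}" for x
        using bounds[of x] max[of s x] that order by auto
      show "\<bar>g x - g y\<bar> < \<epsilon>" if "x \<in> {t..v}" "y \<in> {t..v}" "\<bar>x - y\<bar> < \<omega>" for x y
        using modulus that order by auto
    qed (use order lengths False st in auto)
    then obtain \<eta>3 where \<eta>3: "\<eta>3 > 0" "crooked_liftable \<epsilon> g t v \<eta>3" by blast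
    \<comment> \<open>Including \<epsilon> in the minimum gives
      \<open>5 * \<eta> \<le> \<epsilon>\<close>, which is less than the drop.\<close>
    define \<eta> where "\<eta> = min (min \<eta>1 \<eta>2) (min \<eta>3 \<epsilon>) / 5"
    have "\<eta> > 0" "4 * \<eta> \<le> \<eta>1" "4 * \<eta> \<le> \<eta>2" "4 * \<eta> \<le> \<eta>3" "5 * \<eta> < g s - g t"
      using \<eta>1 \<eta>2 \<eta>3 \<open>\<epsilon> > 0\<close> False by (auto simp: \<eta>_def)
    then have "crooked_liftable \<epsilon> g u v \<eta>"
      using order bounds \<eta>1 \<eta>2 \<eta>3
      by (intro crooked_liftable_zigzag[of u s t v g \<eta> \<epsilon>]) (auto intro: crooked_liftable_antimono)
    then show ?thesis using \<open>\<eta> > 0\<close> by blast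
  qed
qed

section \<open>Reduction to extrema at the ends, and surjectivity of the factor\<close>

theorem theorem2p25:
  fixes g :: "real \<Rightarrow> real" and \<epsilon> :: real
  assumes "cont_surj01 g" and "\<epsilon> > 0"
  shows "\<exists>\<delta>>0. \<forall>f. cont_surj01 f \<and> crooked \<delta> f \<longrightarrow>
           (\<exists>h. cont_surj01 h \<and> approx01 \<epsilon> f (g \<circ> h))"
proof -
  have g_cont: "continuous_on {0..1} g" and g_surj: "g ` {0..1} = {0..1}"
    using assms(1) by (auto simp: cont_surj01_def)
  have "0 \<in> g ` {0..1}" "1 \<in> g ` {0..1}"
    using g_surj by auto
  then obtain s t where s: "s \<in> {0..1}" "g s = 0" and t: "t \<in> {0..1}" "g t = 1"
    by (metis imageE)
  text \<open>The path \<open>r\<close> runs from \<open>s\<close> to \<open>0\<close>, then to \<open>1\<close>, then to \<open>t\<close>: it is onto, and \<open>g \<circ> r\<close>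
    has its minimum and maximum at the ends.\<close>
  define r where "r = (\<lambda>x::real. s * max 0 (1 - x) + max 0 (min 1 (x - 1)) - (1 - t) * max 0 (x - 2))"
  have r_cont: "continuous_on A r" for A
    unfolding r_def by (intro continuous_intros)
  have r01: "r x \<in> {0..1}" if x: "x \<in> {0..3}" for x
  proof -
    consider "x \<le> 1" | "1 \<le> x" "x \<le> 2" | "2 \<le> x" by linarith
    then show ?thesis
    proof cases
      case 1
      then show ?thesis using x s by (auto simp: r_def max_def min_def mult_le_one)
    next
      case 2
      then show ?thesis by (auto simp: r_def max_def min_def)
    next
      case 3
      then have "0 \<le> (1 - t) * (x - 2)" "(1 - t) * (x - 2) \<le> 1"
        using x t by (auto intro: mult_le_one)
      with 3 show ?thesis by (auto simp: r_def max_def min_def)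
    qed
  qed
  have r_ends: "r 0 = s" "r 3 = t"
    by (auto simp: r_def)
  define G where "G = (\<lambda>x. g (r x))"
  have G_cont: "continuous_on {0..3} G"
    unfolding G_def using r01 by (intro continuous_on_compose2[OF g_cont r_cont]) auto
  have G01: "G x \<in> {0..1}" if "x \<in> {0..3}" for x
    using g_surj r01[OF that] unfolding G_def by blast
  have G_ends: "G 0 = 0" "G 3 = 1"
    by (simp_all add: G_def r_ends s t)
  \<comment> \<open>The bound 1 ensures \<open>G 3 - G 0 \<ge> e\<close>; the divisor 6 leaves room
    for a strict inequality after the lifting error \<open>3 * e\<close>.\<close>
  define e where "e = min 1 (\<epsilon> / 6)"
  have e: "0 < e" "e \<le> 1" "3 * e < \<epsilon>"
    using assms(2) by (auto simp: e_def)
  have "uniformly_continuous_on {0..3} G"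
    using G_cont by (intro compact_uniformly_continuous) auto
  then obtain \<omega> where "\<omega> > 0"
    and \<omega>: "\<And>x y. x \<in> {0..3} \<Longrightarrow> y \<in> {0..3} \<Longrightarrow> \<bar>x - y\<bar> < \<omega> \<Longrightarrow> \<bar>G x - G y\<bar> < e"
    using e(1) unfolding uniformly_continuous_on_def dist_real_def by metis
  obtain n where n: "3 - 0 \<le> real n * \<omega>"
    using \<open>\<omega> > 0\<close> by (metis diff_zero less_imp_le reals_Archimedean3)
  obtain \<eta> where "\<eta> > 0" and \<eta>: "crooked_liftable e G 0 3 \<eta>"
    using ex_crooked_liftable[of e 0 3 G n \<omega>] G_cont G01 G_ends e n \<omega> by auto
  have "\<exists>h. cont_surj01 h \<and> approx01 \<epsilon> f (g \<circ> h)" if f: "cont_surj01 f" "crooked \<eta> f" for f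
  proof -
    obtain k where k_cont: "continuous_on {0..1} k"
      and k: "\<And>x. x \<in> {0..1} \<Longrightarrow> clamp_lift e \<eta> G 0 3 f x (k x)"
      using \<eta> f(2) unfolding crooked_liftable_def section_on_def by blast
    have f_surj: "f ` {0..1} = {0..1}"
      using f(1) by (simp add: cont_surj01_def)
    have k03: "k ` {0..1} \<subseteq> {0..3}"
      using k by (auto simp: clamp_lift_def)
    have "0 \<in> f ` {0..1}" "1 \<in> f ` {0..1}"
      using f_surj by auto
    then obtain a b where a: "a \<in> {0..1}" "f a = 0" and b: "b \<in> {0..1}" "f b = 1"
      by (metis imageE)
    \<comment> \<open>The end clauses of \<open>clamp_lift\<close> make \<open>k\<close> reach both
      ends, hence all of \<open>{0..3}\<close>. So \<open>r \<circ> k\<close> is onto, and it serves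
      as the factor \<open>h\<close>.\<close>
    have "k a = 0" "k b = 3"
      using k[OF a(1)] k[OF b(1)] a b \<open>\<eta> > 0\<close> by (auto simp: clamp_lift_def G_ends)
    then have "0 \<in> k ` {0..1}" "3 \<in> k ` {0..1}"
      using a b by (metis imageI)+
    moreover have "is_interval (k ` {0..1})"
      using k_cont by (simp add: is_interval_connected_1 connected_continuous_image)
    ultimately have k_surj: "y \<in> k ` {0..1}" if "y \<in> {0..3}" for y
      using that unfolding is_interval_1 by (meson atLeastAtMost_iff)
    have "y \<in> (r \<circ> k) ` {0..1}" if y: "y \<in> {0..1}" for y
    proof -
      \<comment> \<open>On \<open>{1..2}\<close> the path \<open>r\<close> is translation by -1, so
        this stretch alone covers \<open>{0..1}\<close>.\<close>
      have "r (y + 1) = y"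
        using y by (auto simp: r_def max_def min_def)
      moreover have "y + 1 \<in> k ` {0..1}"
        using k_surj[of "y + 1"] y by auto
      ultimately show ?thesis
        by (force simp: image_comp[symmetric])
    qed
    moreover have "(r \<circ> k) ` {0..1} \<subseteq> {0..1}"
      using r01 k03 by (simp add: image_subset_iff)
    moreover have "continuous_on {0..1} (r \<circ> k)"
      using k_cont r_cont by (rule continuous_on_compose)
    ultimately have "cont_surj01 (r \<circ> k)"
      unfolding cont_surj01_def by blast
    moreover have "\<bar>f x - (g \<circ> (r \<circ> k)) x\<bar> \<le> 3 * e" if x: "x \<in> {0..1}" for x
    proof -
      have "f x \<in> {0..1}" using f_surj x by blast
      then have "max 0 (min 1 (f x)) = f x" by auto
      then show ?thesis
        using k[OF x] by (simp add: clamp_lift_def G_ends abs_minus_commute) (simp add: G_def)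
    qed
    then have "(SUP x\<in>{0..1}. \<bar>f x - (g \<circ> (r \<circ> k)) x\<bar>) \<le> 3 * e"
      by (intro cSUP_least) auto
    then have "approx01 \<epsilon> f (g \<circ> (r \<circ> k))"
      unfolding approx01_def using e(3) by linarith
    ultimately show ?thesis by blast
  qed
  then show ?thesis
    using \<open>\<eta> > 0\<close> by blast
qed

end
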